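(* Let $K$ be a field of characteristic zero and let $k \geq 2$ be an integer. Let $f \colon K[X] \to K[X]$ be a $K$-linear bijection such that at least one of the following holds: (i) $f$ preserves the set of $k$-free polynomials of $K[X]$; (ii) $f$ preserves the set of polynomials of $K[X]$ with no $k$-fold root in $K$. Then there are constants $a, c \in K^{\times}$ and $b \in K$ such that $$\forall P \in K[X], \quad f(P) = c \cdot P(aX+b).$$ In other words, the following three sets of maps $K[X]\to K[X]$ are equal: the set of $K$-linear bijections preserving the set of $k$-free polynomials; the set of $K$-linear bijections preserving the set of polynomials with a $k$-fold root in $K$; and the set $K^{\times} \rtimes \mathrm{Aut}_{K\text{-alg}}(K[X])$ of maps of the form $P \mapsto c\,\varphi(P)$ with $c \in K^{\times}$ and $\varphi$ a $K$-algebra automorphism of $K[X]$.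
   Context: A map $f$ preserves a set $S$ if $f(S) = S$ (for a bijection $f$ this means: $P \in S$ if and only if $f(P) \in S$). A polynomial in $K[X]$ is $k$-free if it does not belong to $m^k$ for any maximal ideal $m$ of $K[X]$, i.e., if it is not divisible by the $k$-th power of any irreducible polynomial of $K[X]$ (so $0$ is not $k$-free). A $k$-fold root of a polynomial $P$ in $K$ is an element $x \in K$ which is a root of multiplicity $\geq k$, i.e., such that $(X-x)^k$ divides $P$ (so every $x\in K$ is a $k$-fold root of $0$). *)

theory Defs
  imports "HOL-Computational_Algebra.Polynomial"
begin

definition preserves :: "('a \<Rightarrow> 'a) \<Rightarrow> 'a set \<Rightarrow> bool" where
  "preserves f S \<longleftrightarrow> f ` S = S"

definition k_free :: "nat \<Rightarrow> 'a::field poly \<Rightarrow> bool" where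
  "k_free k P \<longleftrightarrow> \<not> (\<exists>q. irreducible q \<and> q ^ k dvd P)"

text \<open>Multiplicity at least \<open>k\<close> is stated by divisibility rather than through \<^const>\<open>order\<close>,
  so that every element is a \<open>k\<close>-fold root of \<open>0\<close>.\<close>

definition k_fold_root :: "nat \<Rightarrow> 'a::field poly \<Rightarrow> 'a \<Rightarrow> bool" where
  "k_fold_root k P x \<longleftrightarrow> [:- x, 1:] ^ k dvd P"

definition linear_bijection :: "('a::field poly \<Rightarrow> 'a poly) \<Rightarrow> bool" where
  "linear_bijection f \<longleftrightarrow> Vector_Spaces.linear smult smult f \<and> bij f"

definition algebra_automorphism :: "('a::field poly \<Rightarrow> 'a poly) \<Rightarrow> bool" where
  "algebra_automorphism \<phi> \<longleftrightarrow>
     linear_bijection \<phi> \<and> \<phi> 1 = 1 \<and> (\<forall>P Q. \<phi> (P * Q) = \<phi> P * \<phi> Q)"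

end

theory Submission
  imports Defs "Jordan_Normal_Form.Determinant"
begin

hide_const (open) Module.smult

text \<open>
  Write \<open>W\<^sub>q\<close> for the ideal generated by \<open>q ^ k\<close>. The polynomials that are not \<open>k\<close>-free, or that have
  a \<open>k\<close>-fold root in the field, form the union of the \<open>W\<^sub>q\<close> over a set \<open>Q\<close> of monic irreducible
  polynomials \<open>q\<close>. The proof recovers \<open>f\<close> from its effect on such a union.

  A Bertini argument shows that a linear subspace inside the union lies in a single \<open>W\<^sub>q\<close>
  (\<open>subspace_common_power_factor\<close>): a generic member of the pencil \<open>P + t R\<close> has no \<open>k\<close>-th power
  factor except common ones, because such a factor divides the Wronskian of \<open>P\<close> and \<open>R\<close>. Hence \<open>f\<close>
  permutes the \<open>W\<^sub>q\<close> with \<open>q \<in> Q\<close> (\<open>power_ideals_permuted\<close>). Comparing codimensions, it maps linear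
  \<open>q\<close> to linear ones (\<open>linear_factor_image_degree\<close>). So there is a bijection \<open>\<sigma>\<close> of the field such that
  \<open>x\<close> is a \<open>k\<close>-fold root of \<open>P\<close> if and only if \<open>\<sigma> x\<close> is one of \<open>f P\<close>.

  Consequently the \<open>(k - 1)\<close>-jet of \<open>f P\<close> at \<open>y\<close> is obtained by an invertible matrix from the jet of \<open>P\<close>
  at \<open>\<tau> y\<close>, where \<open>\<tau>\<close> is the inverse of \<open>\<sigma>\<close>. Taking the Wronskian of the images of
  \<open>1, X, \<dots>, X\<^sup>k\<^sup>-\<^sup>2, X\<^sup>k\<^sup>-\<^sup>1\<^sup>+\<^sup>m\<close> for all \<open>m\<close> yields a polynomial \<open>E\<close> without zeros such that every
  \<open>E \<tau> ^ m\<close> is polynomial, and integral closedness of the polynomial ring makes \<open>\<tau>\<close> itself polynomial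
  (\<open>jet_transport_polynomial\<close>). The same holds for \<open>\<sigma>\<close>, so \<open>\<sigma>\<close> and \<open>\<tau>\<close> are affine.

  Composing with an affine substitution reduces to an operator that respects \<open>k\<close>-fold roots at every
  point. It is a differential operator of order less than \<open>k\<close>, and its action on \<open>(X - x) ^ k\<close> shows
  that the order is zero (\<open>local_operator_is_multiplication\<close>). A surjective multiplication operator is
  multiplication by a nonzero constant. The converse inclusions are formal, since automorphisms
  preserve irreducibility and substitutions \<open>P(a X + b)\<close> move roots.
\<close>

section \<open>Generic members of a pencil and power factors\<close>

text \<open>The parameter \<open>Q\<close> lets both properties of the theorem be treated at once: \<open>P\<close> is \<open>k\<close>-free if
  and only if this set is empty for \<open>Q\<close> the monic irreducible polynomials, and \<open>P\<close> has no \<open>k\<close>-fold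
  root if and only if it is empty for \<open>Q\<close> the polynomials \<open>X - x\<close>.\<close>

definition power_factors :: "'a::field poly set \<Rightarrow> nat \<Rightarrow> 'a poly \<Rightarrow> 'a poly set" where
  "power_factors Q k P = {q \<in> Q. q ^ k dvd P}"

abbreviation monic_irreducibles :: "'a::field poly set" where
  "monic_irreducibles \<equiv> {q. irreducible q \<and> lead_coeff q = 1}"

lemma monic_associated_eq:
  fixes p q :: "'a::field poly"
  assumes "irreducible q" "p dvd q" "\<not> p dvd 1" "lead_coeff p = 1" "lead_coeff q = 1"
  shows "p = q"
proof -
  obtain r where r: "q = p * r" using assms(2) by (auto elim: dvdE)
  with assms(1,3) have "r dvd 1" by (auto simp: irreducible_def)
  then obtain c where "r = [:c:]" by (auto simp: is_unit_poly_iff)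
  with r assms(4,5) show ?thesis by (auto simp: lead_coeff_mult one_pCons split: if_splits)
qed

text \<open>Split off one monic irreducible divisor \<open>p\<close> of \<open>w\<close>, say \<open>w = p * v\<close>: since irreducible
  polynomials over a field are prime, every other one divides \<open>v\<close>, which has smaller degree.\<close>

lemma finite_monic_irreducible_divisors:
  fixes w :: "'a::field poly"
  assumes "w \<noteq> 0"
  shows "finite {q \<in> monic_irreducibles. q dvd w}"
  using assms
proof (induction "degree w" arbitrary: w rule: less_induct)
  case less
  show ?case
  proof (cases "\<exists>q. irreducible q \<and> lead_coeff q = 1 \<and> q dvd w")
    case True
    then obtain p where p: "irreducible p" "lead_coeff p = 1" "p dvd w" by blast
    then obtain v where v: "w = p * v" by (auto elim: dvdE)
    with less.prems have v0: "v \<noteq> 0" and p0: "p \<noteq> 0" by auto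
    have "degree p \<noteq> 0"
      using p(1) p0 is_unit_iff_degree[OF p0] by (auto simp: irreducible_def)
    then have "degree v < degree w" using v v0 p0 by (simp add: degree_mult_eq)
    then have fin: "finite {q \<in> monic_irreducibles. q dvd v}" using less.hyps v0 by blast
    have "q \<in> insert p {q \<in> monic_irreducibles. q dvd v}"
      if q: "irreducible q" "lead_coeff q = 1" "q dvd w" for q
    proof -
      have "q dvd p \<or> q dvd v"
        using q(3) field_poly_irreducible_imp_prime[OF q(1)]
        unfolding v by (simp add: prime_elem_dvd_mult_iff)
      moreover have "\<not> q dvd 1" using q(1) by (simp add: irreducible_def)
      ultimately show ?thesis
        using monic_associated_eq[OF p(1)] p(2) q by auto
    qed
    then have "{q \<in> monic_irreducibles. q dvd w} \<subseteq> insert p {q \<in> monic_irreducibles. q dvd v}"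
      by blast
    with fin show ?thesis by (meson finite.insertI finite_subset)
  next
    case False
    then have "{q \<in> monic_irreducibles. q dvd w} = {}" by blast
    then show ?thesis by (simp only: finite.emptyI)
  qed
qed

text \<open>A vanishing Wronskian says that \<open>(R / P)' = 0\<close>. Without fractions: comparing leading
  coefficients shows that two nonzero polynomials with vanishing Wronskian have equal degree (this
  uses characteristic zero), and subtracting from \<open>R\<close> the multiple of \<open>P\<close> with the same leading
  coefficient leaves a polynomial \<open>D\<close> whose Wronskian with \<open>P\<close> still vanishes but whose degree
  differs from that of \<open>P\<close>, unless \<open>D = 0\<close>.\<close>

lemma wronskian_zero_imp_proportional:
  fixes P R :: "'a::field_char_0 poly"
  assumes w: "pderiv P * R = P * pderiv R" and P: "P \<noteq> 0"
  shows "\<exists>c. R = smult c P"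
proof (cases "R = 0")
  case True
  then show ?thesis by (intro exI[of _ 0]) simp
next
  case R: False
  have deg: "degree A = degree B"
    if "pderiv A * B = A * pderiv B" "A \<noteq> 0" "B \<noteq> 0" for A B :: "'a poly"
  proof -
    have "degree A = 0 \<longleftrightarrow> degree B = 0"
      using that by (metis mult_eq_0_iff pderiv_eq_0_iff)
    moreover have "degree A = degree B" if "degree A \<noteq> 0" "degree B \<noteq> 0"
    proof -
      have "lead_coeff (pderiv A * B) = lead_coeff (A * pderiv B)"
        using \<open>pderiv A * B = A * pderiv B\<close> by simp
      then have "of_nat (degree A) * (lead_coeff A * lead_coeff B)
               = of_nat (degree B) * (lead_coeff A * lead_coeff B)"
        using that by (simp add: lead_coeff_mult degree_pderiv coeff_pderiv algebra_simps)
      then show ?thesis using \<open>A \<noteq> 0\<close> \<open>B \<noteq> 0\<close> by simp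
    qed
    ultimately show ?thesis by metis
  qed
  define c where "c = lead_coeff R / lead_coeff P"
  define D where "D = R - smult c P"
  have "pderiv P * D = P * pderiv D"
    using w by (simp add: D_def pderiv_diff pderiv_smult algebra_simps)
  moreover have "D = 0 \<or> degree D \<noteq> degree P"
  proof -
    have dR: "degree R = degree P" using deg[OF w P R] by simp
    have c0: "coeff D (degree P) = 0"
      using P dR by (simp add: D_def c_def)
    then show ?thesis by (metis leading_coeff_0_iff)
  qed
  ultimately have "D = 0" using deg P by metis
  then show ?thesis by (auto simp: D_def)
qed

lemma power_dvd_pderiv:
  fixes q P :: "'a::field poly"
  assumes "q ^ Suc n dvd P"
  shows "q ^ n dvd pderiv P"
proof -
  obtain S where S: "P = q ^ Suc n * S" using assms by (auto elim: dvdE)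
  have "pderiv P = q ^ n * (q * pderiv S + smult (of_nat (Suc n)) (pderiv q) * S)"
    unfolding S pderiv_mult pderiv_power_Suc by (simp add: algebra_simps)
  then show ?thesis by simp
qed

text \<open>A Bertini statement: apart from finitely many parameters \<open>t\<close>, a member \<open>P + t R\<close> of a pencil
  has no \<open>k\<close>-th power factors beyond the common ones of \<open>P\<close> and \<open>R\<close>. If \<open>q ^ k\<close> divides
  \<open>P + t R\<close> with \<open>k \<ge> 2\<close>, then \<open>q\<close> divides \<open>P + t R\<close> and its derivative, hence the Wronskian of
  \<open>P\<close> and \<open>R\<close>, which does not depend on \<open>t\<close>. This leaves finitely many \<open>q\<close>, and a given \<open>q\<close>
  which occurs for two values of \<open>t\<close> has its \<open>k\<close>-th power dividing both \<open>P\<close> and \<open>R\<close>.\<close>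

lemma pencil_generic_member:
  fixes P R :: "'a::field_char_0 poly"
  assumes Q: "Q \<subseteq> monic_irreducibles" and k: "k \<ge> 2"
    and w: "pderiv P * R \<noteq> P * pderiv R"
  shows "finite {t. \<not> power_factors Q k (P + smult t R) \<subseteq> power_factors Q k P \<inter> power_factors Q k R}"
    (is "finite ?T")
proof -
  define w where "w = pderiv P * R - P * pderiv R"
  have w0: "w \<noteq> 0" using assms(3) by (simp add: w_def)
  have "\<exists>q. q \<in> Q \<and> q ^ k dvd P + smult t R \<and> \<not> (q ^ k dvd P \<and> q ^ k dvd R)" if "t \<in> ?T" for t
    using that by (auto simp: power_factors_def)
  then obtain g where g: "\<And>t. t \<in> ?T \<Longrightarrow> g t \<in> Q \<and> g t ^ k dvd P + smult t R
      \<and> \<not> (g t ^ k dvd P \<and> g t ^ k dvd R)" by metis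
  have dvd_w: "g t dvd w" if t: "t \<in> ?T" for t
  proof -
    obtain n where n: "k = Suc (Suc n)" using k by (metis add_2_eq_Suc le_Suc_ex)
    have "g t dvd g t ^ Suc n" by simp
    then have d1: "g t dvd pderiv (P + smult t R)"
      using power_dvd_pderiv[of "g t" "Suc n"] g[OF t] n by (metis dvd_trans)
    have "g t dvd g t ^ k" using n by simp
    then have d2: "g t dvd P + smult t R" using g[OF t] by (metis dvd_trans)
    have "w = pderiv (P + smult t R) * R - (P + smult t R) * pderiv R"
      by (simp add: w_def pderiv_add pderiv_smult algebra_simps)
    then show ?thesis using d1 d2 by simp
  qed
  have "inj_on g ?T"
  proof (rule inj_onI, rule ccontr)
    fix s t assume st: "s \<in> ?T" "t \<in> ?T" "g s = g t" "s \<noteq> t"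
    let ?q = "g s ^ k"
    have "?q dvd (P + smult s R) - (P + smult t R)"
      using g[OF st(1)] g[OF st(2)] st(3) by (intro dvd_diff) auto
    also have "(P + smult s R) - (P + smult t R) = smult (s - t) R"
      by (simp add: smult_diff_left)
    finally have R: "?q dvd R" using st(4) by (simp add: dvd_smult_iff)
    have "?q dvd (P + smult s R) - smult s R"
      using g[OF st(1)] R by (intro dvd_diff) (auto intro: dvd_smult)
    then have "?q dvd P" by simp
    with R g[OF st(1)] show False by blast
  qed
  moreover have "g ` ?T \<subseteq> {q \<in> monic_irreducibles. q dvd w}"
    using g dvd_w Q by blast
  ultimately show ?thesis
    using finite_monic_irreducible_divisors[OF w0] by (meson finite_subset finite_imageD)
qed

text \<open>Take a nonzero \<open>P \<in> V\<close> with the least number of \<open>k\<close>-th power factors. For \<open>R \<in> V\<close> a generic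
  member of the pencil \<open>P + t R\<close> has only the common factors of \<open>P\<close> and \<open>R\<close>, so by minimality
  all factors of \<open>P\<close> are factors of \<open>R\<close>.\<close>

lemma subspace_common_power_factor:
  fixes V :: "'a::field_char_0 poly set"
  assumes Q: "Q \<subseteq> monic_irreducibles" and k: "k \<ge> 2"
    and V: "\<And>P R. P \<in> V \<Longrightarrow> R \<in> V \<Longrightarrow> P + R \<in> V" "\<And>c P. P \<in> V \<Longrightarrow> smult c P \<in> V"
    and ne: "\<And>P. P \<in> V \<Longrightarrow> power_factors Q k P \<noteq> {}"
    and nz: "P1 \<in> V" "P1 \<noteq> 0"
  shows "\<exists>q\<in>Q. \<forall>R\<in>V. q ^ k dvd R"
proof -
  let ?F = "power_factors Q k"
  define m where "m = (LEAST n. \<exists>P\<in>V. P \<noteq> 0 \<and> card (?F P) = n)"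
  have "\<exists>P\<in>V. P \<noteq> 0 \<and> card (?F P) = m"
    unfolding m_def by (rule LeastI_ex) (use nz in blast)
  then obtain P where P: "P \<in> V" "P \<noteq> 0" "card (?F P) = m" by blast
  have min: "m \<le> card (?F S)" if "S \<in> V" "S \<noteq> 0" for S
    unfolding m_def by (rule Least_le) (use that in blast)
  have finP: "finite (?F P)"
  proof (rule finite_subset[OF _ finite_monic_irreducible_divisors[OF P(2)]])
    have "q dvd q ^ k" for q :: "'a poly" using k by (simp add: dvd_power)
    then show "?F P \<subseteq> {q \<in> monic_irreducibles. q dvd P}"
      using Q by (auto simp: power_factors_def intro: dvd_trans)
  qed
  have sub: "?F P \<subseteq> ?F R" if R: "R \<in> V" for R
  proof (cases "pderiv P * R = P * pderiv R")
    case True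
    then obtain c where "R = smult c P" using wronskian_zero_imp_proportional P(2) by blast
    then show ?thesis by (auto simp: power_factors_def intro: dvd_smult)
  next
    case False
    let ?T = "{t. \<not> ?F (P + smult t R) \<subseteq> ?F P \<inter> ?F R}"
    have "finite ?T" by (rule pencil_generic_member[OF Q k False])
    then obtain t where t: "t \<notin> ?T"
      using infinite_UNIV_char_0 ex_new_if_finite by blast
    have "P + smult t R \<noteq> 0"
    proof
      assume *: "P + smult t R = 0"
      then have "P = smult (- t) R" by (simp add: eq_neg_iff_add_eq_0)
      then have "pderiv P * R = P * pderiv R" by (simp add: pderiv_minus pderiv_smult mult.commute)
      with False show False by simp
    qed
    then have "m \<le> card (?F (P + smult t R))" using V P R min by blast
    also have "\<dots> \<le> card (?F P \<inter> ?F R)" using t finP by (intro card_mono) auto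
    finally have "?F P \<inter> ?F R = ?F P" using P(3) finP by (intro card_seteq) auto
    then show ?thesis by blast
  qed
  obtain q where "q \<in> ?F P" using ne P(1) by blast
  with sub show ?thesis by (fastforce simp: power_factors_def)
qed

section \<open>Power ideals under a linear bijection\<close>

lemma linear_simps:
  assumes "Vector_Spaces.linear smult smult (f :: 'a::field poly \<Rightarrow> 'a poly)"
  shows "f (P + R) = f P + f R" "f (smult c P) = smult c (f P)" "f 0 = 0"
    "f (sum h A) = (\<Sum>i\<in>A. f (h i))"
proof -
  interpret Vector_Spaces.linear smult smult f by (fact assms)
  show "f (P + R) = f P + f R" "f (smult c P) = smult c (f P)" "f 0 = 0"
    "f (sum h A) = (\<Sum>i\<in>A. f (h i))"
    by (simp_all add: add scale zero sum)
qed

lemma linearI: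
  fixes f :: "'a::field poly \<Rightarrow> 'a poly"
  assumes "\<And>P R. f (P + R) = f P + f R" "\<And>c P. f (smult c P) = smult c (f P)"
  shows "Vector_Spaces.linear smult smult f"
  by unfold_locales (simp_all add: assms smult_add_left smult_add_right)

lemma linear_bijection_inv:
  assumes "linear_bijection f"
  shows "linear_bijection (inv_into UNIV f)"
proof -
  have bij: "bij f" and f: "Vector_Spaces.linear smult smult f"
    using assms by (simp_all add: linear_bijection_def)
  have fi: "f (inv_into UNIV f P) = P" "inv_into UNIV f (f P) = P" for P
    using bij by (simp_all add: bij_is_surj surj_f_inv_f bij_is_inj)
  have "Vector_Spaces.linear smult smult (inv_into UNIV f)"
  proof (rule linearI)
    show "inv_into UNIV f (P + R) = inv_into UNIV f P + inv_into UNIV f R" for P R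
      using fi(2)[of "inv_into UNIV f P + inv_into UNIV f R"] by (simp add: linear_simps(1)[OF f] fi(1))
    show "inv_into UNIV f (smult c P) = smult c (inv_into UNIV f P)" for c P
      using fi(2)[of "smult c (inv_into UNIV f P)"] by (simp add: linear_simps(2)[OF f] fi(1))
  qed
  with bij show ?thesis by (simp add: linear_bijection_def bij_imp_bij_inv)
qed

lemma surj_all_iff: "surj f \<Longrightarrow> (\<forall>R. B R) \<longleftrightarrow> (\<forall>P. B (f P))"
  by (metis surjD)

lemma bijection_preserves_iff:
  assumes "bij f"
  shows "preserves f {P. A P} \<longleftrightarrow> (\<forall>P. A (f P) \<longleftrightarrow> A P)"
proof -
  have "preserves f {P. A P} \<longleftrightarrow> (\<forall>P. f P \<in> f ` {P. A P} \<longleftrightarrow> A (f P))"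
    unfolding preserves_def set_eq_iff mem_Collect_eq
    using bij_is_surj[OF assms] by (rule surj_all_iff)
  also have "\<dots> \<longleftrightarrow> (\<forall>P. A (f P) \<longleftrightarrow> A P)"
    using assms by (auto simp: inj_image_mem_iff bij_is_inj)
  finally show ?thesis .
qed

text \<open>The image of the ideal generated by \<open>q ^ k\<close> is a linear subspace in which every polynomial has
  a \<open>k\<close>-th power factor.\<close>

lemma maximal_power_ideal_image:
  fixes f :: "'a::field_char_0 poly \<Rightarrow> 'a poly"
  assumes Q: "Q \<subseteq> monic_irreducibles" and k: "k \<ge> 2" and f: "linear_bijection f"
    and pres: "\<And>P. power_factors Q k (f P) = {} \<longleftrightarrow> power_factors Q k P = {}" and q: "q \<in> Q"
  shows "\<exists>q'\<in>Q. \<forall>P. q ^ k dvd P \<longrightarrow> q' ^ k dvd f P"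
proof -
  have bij: "bij f" and lin: "Vector_Spaces.linear smult smult f"
    using f by (simp_all add: linear_bijection_def)
  note f = linear_simps[OF lin]
  let ?V = "f ` {P. q ^ k dvd P}"
  have q0: "q \<noteq> 0" using Q q by auto
  have "\<exists>q'\<in>Q. \<forall>R\<in>?V. q' ^ k dvd R"
  proof (rule subspace_common_power_factor[OF Q k])
    show "A + B \<in> ?V" if AB: "A \<in> ?V" "B \<in> ?V" for A B
    proof -
      from AB obtain A' B' where "A = f A'" "B = f B'" "q ^ k dvd A'" "q ^ k dvd B'" by auto
      then show ?thesis by (intro image_eqI[of _ _ "A' + B'"]) (simp_all add: f)
    qed
    show "smult c A \<in> ?V" if A: "A \<in> ?V" for c A
    proof -
      from A obtain A' where "A = f A'" "q ^ k dvd A'" by auto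
      then show ?thesis by (intro image_eqI[of _ _ "smult c A'"]) (simp_all add: f dvd_smult)
    qed
    show "power_factors Q k A \<noteq> {}" if "A \<in> ?V" for A
      using that q pres by (auto simp: power_factors_def)
    show "f (q ^ k) \<in> ?V" by simp
    have "inj f" using bij by (rule bij_is_inj)
    then show "f (q ^ k) \<noteq> 0" using q0 f(3) by (metis injD power_not_zero)
  qed
  then show ?thesis by blast
qed

text \<open>The inclusion given by \<open>maximal_power_ideal_image\<close> for \<open>f\<close>, followed by the one for
  the inverse of \<open>f\<close>, places the ideal of \<open>q ^ k\<close> inside the ideal of \<open>r ^ k\<close> for some \<open>r\<close> in the
  same set; this forces \<open>r = q\<close>, so both inclusions are equalities.\<close>

lemma power_ideals_permuted:
  fixes f :: "'a::field_char_0 poly \<Rightarrow> 'a poly"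
  assumes Q: "Q \<subseteq> monic_irreducibles" and k: "k \<ge> 2" and f: "linear_bijection f"
    and pres: "\<And>P. power_factors Q k (f P) = {} \<longleftrightarrow> power_factors Q k P = {}" and q: "q \<in> Q"
  shows "\<exists>q'\<in>Q. \<forall>P. q ^ k dvd P \<longleftrightarrow> q' ^ k dvd f P"
proof -
  have bij: "bij f" using f by (simp add: linear_bijection_def)
  have fi: "f (inv_into UNIV f P) = P" "inv_into UNIV f (f P) = P" for P
    using bij by (simp_all add: bij_is_surj surj_f_inv_f bij_is_inj)
  have pres': "power_factors Q k (inv_into UNIV f P) = {} \<longleftrightarrow> power_factors Q k P = {}" for P
    using pres[of "inv_into UNIV f P"] by (simp add: fi)
  obtain q' where q': "q' \<in> Q" "\<And>P. q ^ k dvd P \<Longrightarrow> q' ^ k dvd f P"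
    using maximal_power_ideal_image[OF Q k f pres q] by blast
  obtain r where r: "r \<in> Q" "\<And>P. q' ^ k dvd P \<Longrightarrow> r ^ k dvd inv_into UNIV f P"
    using maximal_power_ideal_image[OF Q k linear_bijection_inv[OF f] pres' q'(1)] by blast
  have "r ^ k dvd q ^ k" using r(2)[OF q'(2)[of "q ^ k"]] fi by simp
  moreover have "r dvd r ^ k" using k by (simp add: dvd_power)
  ultimately have "r dvd q ^ k" by (metis dvd_trans)
  moreover have r': "irreducible r" "lead_coeff r = 1" and q'': "irreducible q" "lead_coeff q = 1"
    using r(1) q Q by auto
  ultimately have "r dvd q"
    using field_poly_irreducible_imp_prime prime_elem_dvd_power by blast
  moreover have "\<not> r dvd 1" using r'(1) by (simp add: irreducible_def)
  ultimately have "r = q" using monic_associated_eq r' q'' by blast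
  with q' r fi show ?thesis by metis
qed

section \<open>Taylor coefficients\<close>

text \<open>The Taylor coefficient \<open>P\<^sup>(\<^sup>i\<^sup>)(x) / i!\<close>, obtained by moving the point \<open>x\<close> to the origin.\<close>

definition jet :: "'a::field \<Rightarrow> 'a poly \<Rightarrow> nat \<Rightarrow> 'a" where
  "jet x P i = coeff (pcompose P [:x, 1:]) i"

lemma jet_add: "jet x (P + R) i = jet x P i + jet x R i"
  by (simp add: jet_def pcompose_add)

lemma jet_smult: "jet x (smult c P) i = c * jet x P i"
  by (simp add: jet_def pcompose_smult)

lemma jet_sum: "jet x (sum h A) i = (\<Sum>a\<in>A. jet x (h a) i)"
  by (simp add: jet_def pcompose_sum coeff_sum)

lemma jet_0 [simp]: "jet x P 0 = poly P x"
  by (simp add: jet_def coeff_pcompose_0)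

lemma pcompose_power: "pcompose (P ^ n) R = pcompose P R ^ n"
  by (induction n) (simp_all add: pcompose_1 pcompose_mult)

lemma pcompose_shift_inverse:
  fixes P :: "'a::field poly"
  shows "pcompose (pcompose P [:x, 1:]) [:- x, 1:] = P"
  by (simp flip: pcompose_assoc add: pcompose_pCons)

lemma dvd_linear_power_iff_jet:
  fixes P :: "'a::field poly"
  shows "[:- x, 1:] ^ k dvd P \<longleftrightarrow> (\<forall>i<k. jet x P i = 0)"
proof -
  have shift: "pcompose ([:- x, 1:] ^ k) [:x, 1:] = monom 1 k"
    by (simp add: pcompose_power pcompose_pCons monom_altdef)
  have "[:- x, 1:] ^ k dvd P \<longleftrightarrow> monom 1 k dvd pcompose P [:x, 1:]"
  proof
    assume "[:- x, 1:] ^ k dvd P"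
    then show "monom 1 k dvd pcompose P [:x, 1:]"
      by (metis shift dvdE dvd_triv_left pcompose_mult)
  next
    assume "monom 1 k dvd pcompose P [:x, 1:]"
    then obtain S where "pcompose P [:x, 1:] = monom 1 k * S" by (auto elim: dvdE)
    then have "P = pcompose (monom 1 k) [:- x, 1:] * pcompose S [:- x, 1:]"
      by (metis pcompose_shift_inverse pcompose_mult)
    moreover have "pcompose (monom 1 k) [:- x, 1:] = [:- x, 1:] ^ k"
      by (metis shift pcompose_shift_inverse)
    ultimately show "[:- x, 1:] ^ k dvd P" by simp
  qed
  then show ?thesis by (simp add: monom_1_dvd_iff' jet_def)
qed

lemma taylor_expansion:
  fixes P :: "'a::field poly"
  assumes "degree P \<le> n"
  shows "P = (\<Sum>i\<le>n. smult (jet x P i) ([:- x, 1:] ^ i))"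
proof -
  let ?R = "pcompose P [:x, 1:]"
  have "degree ?R \<le> n" using assms degree_pcompose_le[of P "[:x, 1:]"] by simp
  then have "?R = (\<Sum>i\<le>n. monom (coeff ?R i) i)" by (metis poly_as_sum_of_monoms')
  then have "P = pcompose (\<Sum>i\<le>n. monom (coeff ?R i) i) [:- x, 1:]"
    by (metis pcompose_shift_inverse)
  also have "\<dots> = (\<Sum>i\<le>n. smult (jet x P i) ([:- x, 1:] ^ i))"
    by (simp add: pcompose_sum monom_altdef pcompose_smult pcompose_power pcompose_pCons jet_def)
  finally show ?thesis .
qed

lemma jet_linear_power: "jet y ([:- x, 1:] ^ n) i = of_nat (n choose i) * (y - x) ^ (n - i)"
proof -
  have "jet y ([:- x, 1:] ^ n) i = coeff ([:y - x, 1:] ^ n) i"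
    by (simp add: jet_def pcompose_power pcompose_pCons)
  then show ?thesis
    by (cases "i \<le> n") (simp_all add: coeff_linear_poly_power coeff_eq_0 degree_linear_power binomial_eq_0)
qed

lemma jet_monomial: "jet y ([:0, 1:] ^ n) i = of_nat (n choose i) * y ^ (n - i)"
  using jet_linear_power[of y 0 n i] by simp

lemma jet_centred_power: "jet x ([:- x, 1:] ^ n) i = (if i = n then 1 else 0)"
  by (cases i n rule: linorder_cases) (simp_all add: jet_linear_power binomial_eq_0)

text \<open>As a function of the centre \<open>x\<close>, a Taylor coefficient is the value of a Hasse derivative.\<close>

lemma jet_polynomial: "\<exists>H. \<forall>x. poly H x = jet x P i"
proof -
  let ?H = "\<Sum>n\<le>degree P. smult (coeff P n * of_nat (n choose i)) ([:0, 1:] ^ (n - i))"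
  have "poly ?H x = jet x P i" for x
  proof -
    have "P = (\<Sum>n\<le>degree P. smult (coeff P n) ([:0, 1:] ^ n))"
      using poly_as_sum_of_monoms[of P] by (simp add: monom_altdef)
    then have "jet x P i = jet x (\<Sum>n\<le>degree P. smult (coeff P n) ([:0, 1:] ^ n)) i" by simp
    also have "\<dots> = poly ?H x"
      by (simp only: jet_sum jet_smult jet_monomial) (simp add: poly_sum poly_power mult.assoc)
    finally show ?thesis by simp
  qed
  then show ?thesis by blast
qed

section \<open>Integrality of polynomial functions\<close>

text \<open>If all powers of \<open>\<tau>\<close> have the common denominator \<open>E\<close>, then \<open>\<tau>\<close> is integral over the
  polynomials. The argument for integral closedness is run here on functions, so that no fractions
  are needed: the universal denominators \<open>U\<close>, those with \<open>U \<tau> ^ m\<close> polynomial for all \<open>m\<close>, form an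
  ideal that is stable under multiplication by \<open>\<tau>\<close>. Its generator \<open>G\<close> divides \<open>G \<tau>\<close>, and \<open>G\<close> has no
  zero because it divides \<open>E\<close>.\<close>

lemma polynomial_function_integrally_closed:
  fixes \<tau> :: "'a::field \<Rightarrow> 'a"
  assumes E: "\<And>y. poly E y \<noteq> 0" and pol: "\<And>m. \<exists>H. \<forall>y. poly H y = poly E y * \<tau> y ^ m"
  shows "\<exists>T. \<forall>y. \<tau> y = poly T y"
proof -
  define S where "S = {U. \<forall>m. \<exists>H. \<forall>y. poly H y = poly U y * \<tau> y ^ m}"
  have diff: "U - V \<in> S" if UV: "U \<in> S" "V \<in> S" for U V
    unfolding S_def
  proof (rule CollectI, rule allI)
    fix m
    from UV obtain H L where "\<forall>y. poly H y = poly U y * \<tau> y ^ m" "\<forall>y. poly L y = poly V y * \<tau> y ^ m"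
      unfolding S_def by blast
    then show "\<exists>H. \<forall>y. poly H y = poly (U - V) y * \<tau> y ^ m"
      by (intro exI[of _ "H - L"]) (simp add: algebra_simps)
  qed
  have mult: "V * U \<in> S" if "U \<in> S" for U V
    unfolding S_def
  proof (rule CollectI, rule allI)
    fix m
    from that obtain H where "\<forall>y. poly H y = poly U y * \<tau> y ^ m"
      unfolding S_def by blast
    then show "\<exists>H. \<forall>y. poly H y = poly (V * U) y * \<tau> y ^ m"
      by (intro exI[of _ "V * H"]) (simp add: algebra_simps)
  qed
  have ES: "E \<in> S" and E0: "E \<noteq> 0" using pol E by (auto simp: S_def)
  define d where "d = (LEAST n. \<exists>U\<in>S. U \<noteq> 0 \<and> degree U = n)"
  have "\<exists>U\<in>S. U \<noteq> 0 \<and> degree U = d"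
    unfolding d_def by (rule LeastI_ex) (use ES E0 in blast)
  then obtain G where G: "G \<in> S" "G \<noteq> 0" "degree G = d" by blast
  have min: "d \<le> degree U" if "U \<in> S" "U \<noteq> 0" for U
    unfolding d_def by (rule Least_le) (use that in blast)
  have dvd: "G dvd U" if U: "U \<in> S" for U
  proof -
    have "U mod G = U - (U div G) * G" by (simp add: minus_div_mult_eq_mod)
    then have "U mod G \<in> S" using diff mult U G(1) by simp
    moreover have "U mod G = 0 \<or> degree (U mod G) < degree G"
      using G(2) by (rule degree_mod_less)
    ultimately have "U mod G = 0" using min G(3) by fastforce
    then show ?thesis by (simp add: dvd_eq_mod_eq_0)
  qed
  have "\<exists>H. \<forall>y. poly H y = poly G y * \<tau> y ^ 1"
    using G(1) unfolding S_def by blast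
  then obtain H where H: "\<And>y. poly H y = poly G y * \<tau> y" by auto
  have "H \<in> S"
    unfolding S_def
  proof (rule CollectI, rule allI)
    fix m
    from G(1) obtain L where "\<forall>y. poly L y = poly G y * \<tau> y ^ Suc m"
      unfolding S_def by blast
    then show "\<exists>L. \<forall>y. poly L y = poly H y * \<tau> y ^ m"
      by (intro exI[of _ L]) (simp add: H algebra_simps)
  qed
  then obtain T where T: "H = G * T" using dvd by (auto elim: dvdE)
  obtain D where D: "E = G * D" using dvd[OF ES] by (auto elim: dvdE)
  have "\<tau> y = poly T y" for y
  proof -
    have "poly G y \<noteq> 0" using E[of y] by (auto simp: D)
    then show ?thesis using H[of y] by (simp add: T)
  qed
  then show ?thesis by blast
qed

section \<open>The action on jets\<close>

text \<open>Expand \<open>P\<close> in powers of \<open>X - x\<close>: the terms of order at least \<open>k\<close> are sent to polynomials with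
  a \<open>k\<close>-fold root at \<open>y\<close>. So \<open>f\<close> induces a linear map from \<open>(k - 1)\<close>-jets at \<open>x\<close> to \<open>(k - 1)\<close>-jets
  at \<open>y\<close>.\<close>

lemma jet_of_image:
  fixes f :: "'a::field poly \<Rightarrow> 'a poly"
  assumes f: "Vector_Spaces.linear smult smult f"
    and tr: "\<And>P. [:- x, 1:] ^ k dvd P \<Longrightarrow> [:- y, 1:] ^ k dvd f P" and i: "i < k"
  shows "jet y (f P) i = (\<Sum>l<k. jet x P l * jet y (f ([:- x, 1:] ^ l)) i)"
proof -
  let ?n = "degree P + k"
  have "f P = f (\<Sum>l\<le>?n. smult (jet x P l) ([:- x, 1:] ^ l))"
    using taylor_expansion[of P ?n x] by simp
  then have "jet y (f P) i = (\<Sum>l\<le>?n. jet x P l * jet y (f ([:- x, 1:] ^ l)) i)"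
    by (simp only: linear_simps[OF f] jet_sum jet_smult)
  also have "\<dots> = (\<Sum>l<k. jet x P l * jet y (f ([:- x, 1:] ^ l)) i)"
  proof (rule sum.mono_neutral_right)
    have "jet y (f ([:- x, 1:] ^ l)) i = 0" if "k \<le> l" for l
    proof -
      have "[:- y, 1:] ^ k dvd f ([:- x, 1:] ^ l)" by (rule tr) (rule le_imp_power_dvd[OF that])
      then show ?thesis using i unfolding dvd_linear_power_iff_jet by blast
    qed
    then show "\<forall>l\<in>{..?n} - {..<k}. jet x P l * jet y (f ([:- x, 1:] ^ l)) i = 0" by simp
  qed auto
  finally show ?thesis .
qed

text \<open>A vector in the kernel of the jet matrix gives a polynomial \<open>P\<close> of degree less than \<open>k\<close> whose
  image has a \<open>k\<close>-fold root at \<open>y\<close>; then \<open>P\<close> has a \<open>k\<close>-fold root at \<open>x\<close>, and all its Taylor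
  coefficients there vanish.\<close>

lemma jet_matrix_invertible:
  fixes f :: "'a::field poly \<Rightarrow> 'a poly"
  assumes f: "Vector_Spaces.linear smult smult f"
    and tr: "\<And>P. [:- y, 1:] ^ k dvd f P \<Longrightarrow> [:- x, 1:] ^ k dvd P"
  shows "det (mat k k (\<lambda>(i, l). jet y (f ([:- x, 1:] ^ l)) i)) \<noteq> 0" (is "det ?B \<noteq> 0")
proof
  have B: "?B \<in> carrier_mat k k" by simp
  assume "det ?B = 0"
  then obtain v where v: "v \<in> carrier_vec k" "v \<noteq> 0\<^sub>v k" "?B *\<^sub>v v = 0\<^sub>v k"
    using det_0_iff_vec_prod_zero[OF B] by blast
  define P where "P = (\<Sum>l<k. smult (v $ l) ([:- x, 1:] ^ l))"
  have "jet y (f P) i = 0" if i: "i < k" for i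
  proof -
    have "jet y (f P) i = (\<Sum>l<k. v $ l * jet y (f ([:- x, 1:] ^ l)) i)"
      by (simp add: P_def linear_simps[OF f] jet_sum jet_smult)
    also have "\<dots> = (?B *\<^sub>v v) $ i"
      using i v(1) by (auto simp: scalar_prod_def atLeast0LessThan intro!: sum.cong)
    finally show ?thesis using v(3) i by simp
  qed
  then have "[:- x, 1:] ^ k dvd P" by (intro tr) (simp add: dvd_linear_power_iff_jet)
  then have "jet x P l = 0" if "l < k" for l using that by (simp add: dvd_linear_power_iff_jet)
  moreover have "jet x P l = v $ l" if "l < k" for l
    using that by (simp add: P_def jet_sum jet_smult jet_centred_power if_distrib cong: if_cong)
  ultimately have "v = 0\<^sub>v k" using v(1) by (intro eq_vecI) auto
  with v(2) show False by simp
qed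

text \<open>Up to the factorials, this is the Wronskian of \<open>1, X, \<dots>, X\<^sup>n\<^sup>-\<^sup>1, X\<^sup>n\<^sup>+\<^sup>m\<close>; the matrix is
  triangular. Replacing only the last exponent is what makes a pure power of \<open>x\<close> appear.\<close>

lemma det_jet_matrix_monomials:
  fixes x :: "'a::field"
  defines "e \<equiv> \<lambda>n m j. if j = n then n + m else j :: nat"
  shows "det (mat (Suc n) (Suc n) (\<lambda>(i, j). jet x ([:0, 1:] ^ e n m j) i))
    = of_nat ((n + m) choose n) * x ^ m" (is "det ?V = _")
proof -
  have "upper_triangular ?V"
    by (auto simp: upper_triangular_def jet_monomial e_def binomial_eq_0)
  then have "det ?V = (\<Prod>i = 0..<Suc n. ?V $$ (i, i))"
    by (subst det_upper_triangular[where n = "Suc n"]) (auto simp: prod_list_diag_prod)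
  also have "\<dots> = of_nat ((n + m) choose n) * x ^ m"
    by (simp add: jet_monomial e_def)
  finally show ?thesis .
qed

text \<open>The Taylor coefficients at \<open>y\<close> of \<open>f (X ^ j)\<close> depend polynomially on \<open>y\<close>, hence so do the
  determinants \<open>J m\<close> formed from the images of \<open>1, X, \<dots>, X\<^sup>n\<^sup>-\<^sup>1, X\<^sup>n\<^sup>+\<^sup>m\<close> where \<open>n = k - 1\<close>. By the chain
  rule for jets, \<open>J m\<close> is a nonzero constant times \<open>det (B y) * \<tau> y ^ m\<close>, where \<open>B y\<close> is the
  invertible matrix of the map that \<open>f\<close> induces on jets. Thus \<open>J 0\<close> has no zero and is a
  denominator of all powers of \<open>\<tau>\<close>.\<close>

lemma jet_transport_polynomial:
  fixes f :: "'a::field_char_0 poly \<Rightarrow> 'a poly"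
  assumes f: "Vector_Spaces.linear smult smult f" and k: "k > 0"
    and tr: "\<And>y P. [:- \<tau> y, 1:] ^ k dvd P \<longleftrightarrow> [:- y, 1:] ^ k dvd f P"
  shows "\<exists>T. \<forall>y. \<tau> y = poly T y"
proof -
  obtain n where n: "k = Suc n" using k by (metis gr0_conv_Suc)
  have "\<forall>P i. \<exists>H. \<forall>y :: 'a. poly H y = jet y P i" using jet_polynomial by blast
  then obtain H :: "'a poly \<Rightarrow> nat \<Rightarrow> 'a poly" where H: "\<And>P i y. poly (H P i) y = jet y P i"
    by metis
  define e where "e = (\<lambda>m j. if j = n then n + m else j :: nat)"
  define J where "J m = det (mat k k (\<lambda>(i, j). H (f ([:0, 1:] ^ e m j)) i))" for m
  define B where "B y = mat k k (\<lambda>(i, l). jet y (f ([:- \<tau> y, 1:] ^ l)) i)" for y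
  have J: "poly (J m) y = det (B y) * (of_nat ((n + m) choose n) * \<tau> y ^ m)" for m y
  proof -
    let ?V = "mat k k (\<lambda>(i, j). jet (\<tau> y) ([:0, 1:] ^ e m j) i)"
    interpret ev: comm_ring_hom "\<lambda>P. poly P y" by unfold_locales auto
    have "poly (J m) y = det (map_mat (\<lambda>P. poly P y) (mat k k (\<lambda>(i, j). H (f ([:0, 1:] ^ e m j)) i)))"
      by (simp add: J_def)
    also have "map_mat (\<lambda>P. poly P y) (mat k k (\<lambda>(i, j). H (f ([:0, 1:] ^ e m j)) i)) = B y * ?V"
    proof (rule eq_matI)
      fix i j assume "i < dim_row (B y * ?V)" "j < dim_col (B y * ?V)"
      then have ij: "i < k" "j < k" by (simp_all add: B_def)
      have "jet y (f ([:0, 1:] ^ e m j)) i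
        = (\<Sum>l<k. jet (\<tau> y) ([:0, 1:] ^ e m j) l * jet y (f ([:- \<tau> y, 1:] ^ l)) i)"
        using jet_of_image[OF f _ ij(1)] tr by blast
      also have "\<dots> = (B y * ?V) $$ (i, j)"
        using ij by (auto simp: B_def scalar_prod_def atLeast0LessThan mult.commute intro!: sum.cong)
      finally show "map_mat (\<lambda>P. poly P y) (mat k k (\<lambda>(i, j). H (f ([:0, 1:] ^ e m j)) i)) $$ (i, j)
        = (B y * ?V) $$ (i, j)"
        using ij by (simp add: H)
    qed (simp_all add: B_def)
    also have "det (B y * ?V) = det (B y) * det ?V"
      by (rule det_mult[of _ k]) (simp_all add: B_def)
    also have "det ?V = of_nat ((n + m) choose n) * \<tau> y ^ m"
      unfolding n e_def by (rule det_jet_matrix_monomials)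
    finally show ?thesis .
  qed
  have B: "det (B y) \<noteq> 0" for y
    unfolding B_def by (rule jet_matrix_invertible[OF f]) (simp add: tr)
  show ?thesis
  proof (rule polynomial_function_integrally_closed)
    show "poly (J 0) y \<noteq> 0" for y using B by (simp add: J)
    show "\<exists>L. \<forall>y. poly L y = poly (J 0) y * \<tau> y ^ m" for m
    proof (intro exI[of _ "smult (inverse (of_nat ((n + m) choose n))) (J m)"] allI)
      have "(n + m) choose n \<noteq> 0" by simp
      then have "of_nat ((n + m) choose n) \<noteq> (0 :: 'a)" unfolding of_nat_eq_0_iff .
      then show "poly (smult (inverse (of_nat ((n + m) choose n))) (J m)) y = poly (J 0) y * \<tau> y ^ m"
        for y by (simp add: J)
    qed
  qed
qed

text \<open>By Taylor expansion \<open>h\<close> is a differential operator \<open>\<Sum>l<k. b\<^sub>l D\<^sup>l / l!\<close> with polynomial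
  coefficients. If its order \<open>r\<close> were positive, then applying it to \<open>(X - x) ^ k\<close> would
  give a polynomial whose expansion at \<open>x\<close> begins with \<open>(k choose r) b\<^sub>r(x) (X - x)\<^sup>k\<^sup>-\<^sup>r\<close>, while
  divisibility by \<open>(X - x) ^ k\<close> forces this term to vanish; this holds for every \<open>x\<close>, so
  \<open>b\<^sub>r = 0\<close>.\<close>

lemma local_operator_is_multiplication:
  fixes h :: "'a::field_char_0 poly \<Rightarrow> 'a poly"
  assumes h: "Vector_Spaces.linear smult smult h" and k: "k > 0"
    and tr: "\<And>x P. [:- x, 1:] ^ k dvd P \<Longrightarrow> [:- x, 1:] ^ k dvd h P"
  shows "h P = h 1 * P"
proof -
  \<comment> \<open>The binomial expansion of \<open>(X - y) ^ l\<close>, with \<open>y\<close> replaced by the variable after \<open>h\<close> is applied.\<close>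
  define b where "b l = (\<Sum>i\<le>l. smult (of_nat (l choose i)) ((- [:0, 1:]) ^ (l - i) * h ([:0, 1:] ^ i)))" for l
  have b: "poly (b l) y = poly (h ([:- y, 1:] ^ l)) y" for l y
  proof -
    have "[:- y, 1:] ^ l = (\<Sum>i\<le>l. smult (of_nat (l choose i) * (- y) ^ (l - i)) ([:0, 1:] ^ i))"
      using taylor_expansion[of "[:- y, 1:] ^ l" l 0] by (simp add: jet_linear_power degree_linear_power)
    then have "h ([:- y, 1:] ^ l) = (\<Sum>i\<le>l. smult (of_nat (l choose i) * (- y) ^ (l - i)) (h ([:0, 1:] ^ i)))"
      by (simp add: linear_simps[OF h])
    then show ?thesis by (simp add: b_def poly_sum poly_power mult.assoc)
  qed
  have hP: "poly (h P) y = (\<Sum>l<k. jet y P l * poly (b l) y)" for P y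
  proof -
    have "jet y (h P) 0 = (\<Sum>l<k. jet y P l * jet y (h ([:- y, 1:] ^ l)) 0)"
      by (rule jet_of_image[OF h tr k])
    then show ?thesis by (simp add: b)
  qed
  have b0: "b l = 0" if l: "0 < l" "l < k" for l
  proof (rule ccontr)
    assume "b l \<noteq> 0"
    define r where "r = Max {l. l < k \<and> b l \<noteq> 0}"
    have fin: "finite {l. l < k \<and> b l \<noteq> 0}" by simp
    have mem: "l \<in> {l. l < k \<and> b l \<noteq> 0}" using l \<open>b l \<noteq> 0\<close> by simp
    have r: "r < k" "b r \<noteq> 0" using Max_in[OF fin] mem unfolding r_def by blast+
    have "l \<le> r" unfolding r_def using fin mem by (rule Max_ge)
    with l have r0: "0 < r" by simp
    have above: "b j = 0" if "r < j" "j < k" for j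
      using Max_ge[OF fin, of j] that unfolding r_def by fastforce
    obtain x where x: "poly (b r) x \<noteq> 0" using r(2) poly_all_0_iff_0 by blast
    let ?L = "[:- x, 1:]"
    let ?t = "\<lambda>l. smult (of_nat (k choose l)) (?L ^ (k - l) * b l)"
    have "poly (h (?L ^ k)) y = poly (\<Sum>l<k. ?t l) y" for y
      by (simp add: hP jet_linear_power poly_sum poly_power mult.assoc)
    then have eq: "h (?L ^ k) = (\<Sum>l<k. ?t l)" by (rule poly_ext)
    \<comment> \<open>In the expansion \<open>eq\<close>, every term but the one of index \<open>r\<close> is divisible by \<open>?L ^ Suc (k - r)\<close>.\<close>
    have "?L ^ Suc (k - r) dvd ?L ^ k" using r(1) r0 by (intro le_imp_power_dvd) simp
    moreover have "?L ^ k dvd h (?L ^ k)" by (rule tr) simp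
    ultimately have "?L ^ Suc (k - r) dvd (\<Sum>l<k. ?t l)" unfolding eq by (rule dvd_trans)
    also have "(\<Sum>l<k. ?t l) = ?t r + (\<Sum>l\<in>{..<k} - {r}. ?t l)"
      using r(1) by (intro sum.remove) auto
    finally have "?L ^ Suc (k - r) dvd ?t r + (\<Sum>l\<in>{..<k} - {r}. ?t l)" .
    moreover have "?L ^ Suc (k - r) dvd (\<Sum>l\<in>{..<k} - {r}. ?t l)"
    proof (rule dvd_sum)
      fix j assume j: "j \<in> {..<k} - {r}"
      show "?L ^ Suc (k - r) dvd ?t j"
      proof (cases "j < r")
        case True
        then have "?L ^ Suc (k - r) dvd ?L ^ (k - j)" using j by (intro le_imp_power_dvd) auto
        then show ?thesis by (intro dvd_smult dvd_mult2)
      next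
        case False
        then show ?thesis using j above by simp
      qed
    qed
    ultimately have "?L ^ Suc (k - r) dvd ?t r" by (simp add: dvd_add_left_iff)
    then have "?L ^ (k - r) * ?L dvd ?L ^ (k - r) * b r"
      using r(1) by (simp add: dvd_smult_iff mult.commute)
    then have "?L dvd b r" by (subst (asm) dvd_mult_cancel_left) simp
    then show False using x by (simp add: dvd_iff_poly_eq_0)
  qed
  have "poly (h P) y = poly (h 1 * P) y" for y
  proof -
    have "poly (h P) y = (\<Sum>l\<in>{0}. jet y P l * poly (b l) y)"
      unfolding hP by (rule sum.mono_neutral_right) (use k b0 in auto)
    also have "\<dots> = poly (h 1 * P) y" by (simp add: b)
    finally show ?thesis .
  qed
  then show ?thesis by (rule poly_ext)
qed

text \<open>The ideal of \<open>(X - x) ^ k\<close> has codimension \<open>k\<close>, so some nontrivial combination \<open>P\<close> of the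
  \<open>k + 1\<close> polynomials \<open>1, X, \<dots>, X\<^sup>k\<close> is the image of an element of this ideal. Then \<open>q ^ k\<close>
  divides the nonzero polynomial \<open>P\<close> of degree at most \<open>k\<close>.\<close>

lemma linear_factor_image_degree:
  fixes f :: "'a::field poly \<Rightarrow> 'a poly"
  assumes f: "linear_bijection f" and k: "k > 0" and q: "irreducible q"
    and tr: "\<And>P. [:- x, 1:] ^ k dvd P \<Longrightarrow> q ^ k dvd f P"
  shows "degree q = 1"
proof -
  have bij: "bij f" using f by (simp add: linear_bijection_def)
  have fi: "f (inv_into UNIV f P) = P" for P
    using bij by (simp add: bij_is_surj surj_f_inv_f)
  let ?g = "inv_into UNIV f"
  have g: "Vector_Spaces.linear smult smult ?g"
    using linear_bijection_inv[OF f] by (simp add: linear_bijection_def)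
  \<comment> \<open>The last row is a row of zeros: it makes the matrix of the \<open>k\<close> jet conditions square.\<close>
  let ?A = "mat (Suc k) (Suc k) (\<lambda>(i, j). if i = k then 0 else jet x (?g (monom 1 j)) i)"
  have A: "?A \<in> carrier_mat (Suc k) (Suc k)" by simp
  have "det ?A = 0"
    unfolding det_def'[OF A] by (intro sum.neutral ballI) simp
  then obtain v where v: "v \<in> carrier_vec (Suc k)" "v \<noteq> 0\<^sub>v (Suc k)" "?A *\<^sub>v v = 0\<^sub>v (Suc k)"
    using det_0_iff_vec_prod_zero[OF A] by blast
  define P where "P = (\<Sum>j<Suc k. smult (v $ j) (monom 1 j))"
  have cP: "coeff P j = (if j < Suc k then v $ j else 0)" for j
    by (simp add: P_def coeff_sum smult_monom if_distrib cong: if_cong)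
  have "jet x (?g P) i = 0" if i: "i < k" for i
  proof -
    have "jet x (?g P) i = (\<Sum>j<Suc k. v $ j * jet x (?g (monom 1 j)) i)"
      by (simp only: P_def linear_simps[OF g] jet_sum jet_smult)
    also have "\<dots> = (?A *\<^sub>v v) $ i"
      using i v(1) by (auto simp: scalar_prod_def atLeast0LessThan mult.commute intro!: sum.cong)
    finally show ?thesis using v(3) i by simp
  qed
  then have "q ^ k dvd P" using tr[of "?g P"] by (simp add: dvd_linear_power_iff_jet fi)
  moreover have "P \<noteq> 0"
  proof
    assume "P = 0"
    then have "v = 0\<^sub>v (Suc k)" using v(1) cP by (intro eq_vecI) (auto, metis coeff_0)
    with v(2) show False by simp
  qed
  ultimately have "degree (q ^ k) \<le> degree P" by (rule dvd_imp_degree_le)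
  also have "\<dots> \<le> k" using cP by (intro degree_le) auto
  finally have "k * degree q \<le> k" using q by (simp add: degree_power_eq irreducible_def)
  moreover have "degree q \<noteq> 0"
    using q is_unit_iff_degree[of q] by (auto simp: irreducible_def)
  ultimately show ?thesis using k by simp
qed

section \<open>Substitution form of a map that transports roots\<close>

lemma linear_power_dvd_imp_eq:
  fixes a b :: "'a::field"
  assumes "[:- a, 1:] ^ k dvd [:- b, 1:] ^ k" "k > 0"
  shows "a = b"
proof -
  have "[:- a, 1:] dvd [:- a, 1:] ^ k" using assms(2) by (simp add: dvd_power)
  then have "[:- a, 1:] dvd [:- b, 1:] ^ k" using assms(1) by (rule dvd_trans)
  then have "poly ([:- b, 1:] ^ k) a = 0" by (rule poly_eq_0_iff_dvd[THEN iffD2])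
  then show ?thesis by (simp add: poly_power)
qed

text \<open>Composing with \<open>S\<close> moves a \<open>k\<close>-fold root at \<open>S(x)\<close> to a \<open>k\<close>-fold root at \<open>x\<close>.\<close>

lemma linear_power_dvd_pcompose:
  fixes S :: "'a::field poly"
  assumes "[:- poly S x, 1:] ^ k dvd P"
  shows "[:- x, 1:] ^ k dvd pcompose P S"
proof -
  obtain R where R: "P = [:- poly S x, 1:] ^ k * R" using assms by (auto elim: dvdE)
  have "poly (pcompose [:- poly S x, 1:] S) x = 0" by (simp add: poly_pcompose)
  then have "[:- x, 1:] dvd pcompose [:- poly S x, 1:] S" by (simp add: poly_eq_0_iff_dvd)
  then have "[:- x, 1:] ^ k dvd pcompose [:- poly S x, 1:] S ^ k" by (rule dvd_power_same)
  then show ?thesis unfolding R pcompose_mult pcompose_power by (rule dvd_mult2)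
qed

lemma polynomial_inverse_linear:
  fixes S T :: "'a::field poly"
  assumes "pcompose S T = [:0, 1:]"
  obtains a b where "a \<noteq> 0" "S = [:b, a:]"
proof -
  have "degree (pcompose S T) = 1" using assms by simp
  then have "degree S = 1" by (simp add: degree_pcompose)
  then obtain a b where "S = [:b, a:]" "a \<noteq> 0" by (rule degree1_coeffs)
  then show thesis using that by blast
qed

text \<open>The bijection \<open>\<sigma>\<close> of roots and its inverse \<open>\<tau>\<close> are both polynomial functions, so both have
  degree one. Undoing the substitution turns \<open>f\<close> into an operator \<open>h\<close> that respects \<open>k\<close>-fold roots
  at every point, hence into multiplication by \<open>h 1\<close>; and \<open>h 1\<close> is a unit because \<open>1\<close> lies in the
  image.\<close>

lemma affine_form_of_root_transport:
  fixes f :: "'a::field_char_0 poly \<Rightarrow> 'a poly"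
  assumes f: "linear_bijection f" and k: "k > 0"
    and fwd: "\<And>x. \<exists>y. \<forall>P. [:- x, 1:] ^ k dvd P \<longleftrightarrow> [:- y, 1:] ^ k dvd f P"
    and bwd: "\<And>y. \<exists>x. \<forall>P. [:- x, 1:] ^ k dvd P \<longleftrightarrow> [:- y, 1:] ^ k dvd f P"
  shows "\<exists>a b c. a \<noteq> 0 \<and> c \<noteq> 0 \<and> (\<forall>P. f P = smult c (pcompose P [:b, a:]))"
proof -
  let ?g = "inv_into UNIV f"
  have bij: "bij f" and lin: "Vector_Spaces.linear smult smult f"
    using f by (simp_all add: linear_bijection_def)
  have fi: "f (?g P) = P" for P
    using bij by (simp add: bij_is_surj surj_f_inv_f)
  have g: "Vector_Spaces.linear smult smult ?g"
    using linear_bijection_inv[OF f] by (simp add: linear_bijection_def)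
  have "\<forall>x. \<exists>y. \<forall>P. [:- x, 1:] ^ k dvd P \<longleftrightarrow> [:- y, 1:] ^ k dvd f P" using fwd by blast
  from choice[OF this] obtain \<sigma> where \<sigma>: "\<And>x P. [:- x, 1:] ^ k dvd P \<longleftrightarrow> [:- \<sigma> x, 1:] ^ k dvd f P"
    by blast
  have "\<forall>y. \<exists>x. \<forall>P. [:- x, 1:] ^ k dvd P \<longleftrightarrow> [:- y, 1:] ^ k dvd f P" using bwd by blast
  from choice[OF this] obtain \<tau> where \<tau>: "\<And>y P. [:- \<tau> y, 1:] ^ k dvd P \<longleftrightarrow> [:- y, 1:] ^ k dvd f P"
    by blast
  have \<tau>\<sigma>: "\<tau> (\<sigma> x) = x" for x
    using \<sigma>[of x "[:- \<tau> (\<sigma> x), 1:] ^ k"] \<tau>[of "\<sigma> x" "[:- x, 1:] ^ k"]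
      \<tau>[of "\<sigma> x" "[:- \<tau> (\<sigma> x), 1:] ^ k"] linear_power_dvd_imp_eq[of x k "\<tau> (\<sigma> x)"] k
    by simp
  have \<sigma>\<tau>: "\<sigma> (\<tau> y) = y" for y
    using \<sigma>[of "\<tau> y" "?g ([:- y, 1:] ^ k)"] \<tau>[of y "?g ([:- y, 1:] ^ k)"]
      linear_power_dvd_imp_eq[of "\<sigma> (\<tau> y)" k y] k
    by (simp add: fi)
  obtain T where T: "\<And>y. \<tau> y = poly T y"
    using jet_transport_polynomial[OF lin k \<tau>] by blast
  have "[:- \<sigma> x, 1:] ^ k dvd P \<longleftrightarrow> [:- x, 1:] ^ k dvd ?g P" for x P
    using \<sigma>[of x "?g P"] by (simp add: fi)
  then obtain S where S: "\<And>x. \<sigma> x = poly S x"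
    using jet_transport_polynomial[OF g k] by blast
  have ST: "pcompose S T = [:0, 1:]"
    by (rule poly_ext) (simp add: poly_pcompose \<sigma>\<tau> flip: S T)
  have TS: "pcompose T S = [:0, 1:]"
    by (rule poly_ext) (simp add: poly_pcompose \<tau>\<sigma> flip: S T)
  define h where "h = (\<lambda>P. pcompose (f P) S)"
  have h: "Vector_Spaces.linear smult smult h"
    by (rule linearI) (simp_all add: h_def linear_simps[OF lin] pcompose_add pcompose_smult)
  have hT: "pcompose (h P) T = f P" for P
    by (simp add: h_def ST flip: pcompose_assoc)
  have mult: "h P = h 1 * P" for P
  proof (rule local_operator_is_multiplication[OF h k])
    fix x :: 'a and P assume "[:- x, 1:] ^ k dvd P"
    then have "[:- poly S x, 1:] ^ k dvd f P" using \<sigma> S by simp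
    then show "[:- x, 1:] ^ k dvd h P" unfolding h_def by (rule linear_power_dvd_pcompose)
  qed
  have "h 1 * ?g 1 = 1"
    using mult[of "?g 1"] by (simp add: h_def fi pcompose_1)
  then have "h 1 dvd 1" by (metis dvd_triv_left)
  then obtain c where c: "h 1 = [:c:]" "c dvd 1" by (auto simp: is_unit_poly_iff)
  then have c0: "c \<noteq> 0" by auto
  obtain a b where ab: "a \<noteq> 0" "T = [:b, a:]" using polynomial_inverse_linear[OF TS] by blast
  have "f P = smult c (pcompose P [:b, a:])" for P
    using hT[of P] mult[of P] by (simp add: c(1) pcompose_smult flip: ab(2))
  with ab(1) c0 show ?thesis by blast
qed

section \<open>Preservers of k-freeness and of k-fold roots\<close>

lemma k_free_iff_power_factors:
  "k_free k P \<longleftrightarrow> power_factors monic_irreducibles k P = {}"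
proof
  assume "k_free k P"
  then show "power_factors monic_irreducibles k P = {}"
    by (auto simp: k_free_def power_factors_def)
next
  assume *: "power_factors monic_irreducibles k P = {}"
  have False if q: "irreducible q" "q ^ k dvd P" for q
  proof -
    have q0: "q \<noteq> 0" using q(1) by (simp add: irreducible_def)
    define r where "r = smult (inverse (lead_coeff q)) q"
    have "[:inverse (lead_coeff q):] dvd 1" using q0 by (simp add: is_unit_poly_iff dvd_field_iff)
    then have "irreducible ([:inverse (lead_coeff q):] * q)"
      using q(1) by (subst irreducible_mult_unit_left)
    then have "irreducible r" by (simp add: r_def)
    moreover have "lead_coeff r = 1" using q0 by (simp add: r_def)
    moreover have "r ^ k dvd P" using q(2) q0 by (simp add: r_def smult_power smult_dvd)
    ultimately show False using * by (auto simp: power_factors_def)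
  qed
  then show "k_free k P" by (auto simp: k_free_def)
qed

definition monic_linears :: "'a::field poly set" where
  "monic_linears = range (\<lambda>x. [:- x, 1:])"

lemma k_fold_root_iff_power_factors:
  "(\<exists>x. k_fold_root k P x) \<longleftrightarrow> power_factors monic_linears k P \<noteq> {}"
  by (auto simp: k_fold_root_def power_factors_def monic_linears_def)

lemma monic_linears_subset: "monic_linears \<subseteq> monic_irreducibles"
  by (auto simp: monic_linears_def irreducible_linear_field_poly)

text \<open>\<open>Q\<close> contains all monic linear polynomials, and the permutation of \<open>Q\<close> induced by \<open>f\<close> maps them
  to linear ones because codimensions are preserved. So \<open>f\<close> transports \<open>k\<close>-fold roots from point to
  point.\<close>

lemma affine_form_of_preserver:
  fixes f :: "'a::field_char_0 poly \<Rightarrow> 'a poly"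
  assumes Q: "monic_linears \<subseteq> Q" "Q \<subseteq> monic_irreducibles" and k: "k \<ge> 2"
    and f: "linear_bijection f"
    and pres: "\<And>P. power_factors Q k (f P) = {} \<longleftrightarrow> power_factors Q k P = {}"
  shows "\<exists>a b c. a \<noteq> 0 \<and> c \<noteq> 0 \<and> (\<forall>P. f P = smult c (pcompose P [:b, a:]))"
proof -
  have k0: "k > 0" using k by simp
  have transport: "\<exists>y. \<forall>P. [:- x, 1:] ^ k dvd P \<longleftrightarrow> [:- y, 1:] ^ k dvd g P"
    if g: "linear_bijection g"
      and pres_g: "\<And>P. power_factors Q k (g P) = {} \<longleftrightarrow> power_factors Q k P = {}" for g x
  proof -
    have "[:- x, 1:] \<in> Q" using Q(1) by (auto simp: monic_linears_def)
    then obtain q where q: "q \<in> Q" "\<And>P. [:- x, 1:] ^ k dvd P \<longleftrightarrow> q ^ k dvd g P"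
      using power_ideals_permuted[OF Q(2) k g pres_g] by blast
    have irr: "irreducible q" "lead_coeff q = 1" using q(1) Q(2) by auto
    have deg: "degree q = 1" using linear_factor_image_degree[OF g k0 irr(1)] q(2) by blast
    then obtain a b where "q = [:b, a:]" "a \<noteq> 0" by (rule degree1_coeffs)
    then have "q = [:- (- b), 1:]" using irr(2) by simp
    with q(2) show ?thesis by blast
  qed
  let ?g = "inv_into UNIV f"
  have bij: "bij f" using f by (simp add: linear_bijection_def)
  have fi: "f (?g P) = P" "?g (f P) = P" for P
    using bij by (simp_all add: bij_is_surj surj_f_inv_f bij_is_inj)
  have pres': "power_factors Q k (?g P) = {} \<longleftrightarrow> power_factors Q k P = {}" for P
    using pres[of "?g P"] by (simp add: fi)
  show ?thesis
  proof (rule affine_form_of_root_transport[OF f k0])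
    show "\<exists>y. \<forall>P. [:- x, 1:] ^ k dvd P \<longleftrightarrow> [:- y, 1:] ^ k dvd f P" for x
      by (rule transport[OF f pres])
    show "\<exists>x. \<forall>P. [:- x, 1:] ^ k dvd P \<longleftrightarrow> [:- y, 1:] ^ k dvd f P" for y
    proof -
      obtain x where "\<forall>P. [:- y, 1:] ^ k dvd P \<longleftrightarrow> [:- x, 1:] ^ k dvd ?g P"
        using transport[OF linear_bijection_inv[OF f] pres'] by blast
      then have "[:- x, 1:] ^ k dvd P \<longleftrightarrow> [:- y, 1:] ^ k dvd f P" for P
        using fi(2)[of P] by metis
      then show ?thesis by blast
    qed
  qed
qed

section \<open>Scaled automorphisms are preservers\<close>

lemma automorphism_inv:
  assumes "algebra_automorphism \<phi>"
  shows "algebra_automorphism (inv_into UNIV \<phi>)"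
proof -
  have \<phi>: "linear_bijection \<phi>" "\<phi> 1 = 1" "\<And>P R. \<phi> (P * R) = \<phi> P * \<phi> R"
    using assms by (simp_all add: algebra_automorphism_def)
  have fi: "\<phi> (inv_into UNIV \<phi> P) = P" "inv_into UNIV \<phi> (\<phi> P) = P" for P
    using \<phi>(1) by (simp_all add: linear_bijection_def bij_is_surj surj_f_inv_f bij_is_inj)
  have "inv_into UNIV \<phi> (P * R) = inv_into UNIV \<phi> P * inv_into UNIV \<phi> R" for P R
    using fi(2)[of "inv_into UNIV \<phi> P * inv_into UNIV \<phi> R"] by (simp add: \<phi>(3) fi(1))
  moreover have "inv_into UNIV \<phi> 1 = 1" using fi(2)[of 1] by (simp add: \<phi>(2))
  ultimately show ?thesis
    using linear_bijection_inv[OF \<phi>(1)] by (simp add: algebra_automorphism_def)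
qed

text \<open>An automorphism maps irreducible polynomials to irreducible polynomials.\<close>

lemma automorphism_k_free_imp:
  assumes \<phi>: "algebra_automorphism \<phi>" and free: "k_free k (\<phi> P)"
  shows "k_free k P"
proof -
  have mult: "\<psi> (A * B) = \<psi> A * \<psi> B" "\<psi> 1 = 1" "\<psi> 0 = 0"
    if "algebra_automorphism \<psi>" for \<psi> :: "'a poly \<Rightarrow> 'a poly" and A B
    using that linear_simps(3)[of \<psi>] by (simp_all add: algebra_automorphism_def linear_bijection_def)
  have dvd: "\<psi> A dvd \<psi> B" if "algebra_automorphism \<psi>" "A dvd B"
    for \<psi> :: "'a poly \<Rightarrow> 'a poly" and A B
    using that(2) by (auto elim!: dvdE simp: mult[OF that(1)])
  have pow: "\<phi> (A ^ n) = \<phi> A ^ n" for A n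
    by (induction n) (simp_all add: mult[OF \<phi>])
  let ?\<psi> = "inv_into UNIV \<phi>"
  note \<psi> = automorphism_inv[OF \<phi>]
  have fi: "\<phi> (?\<psi> A) = A" "?\<psi> (\<phi> A) = A" for A
    using \<phi> by (simp_all add: algebra_automorphism_def linear_bijection_def bij_is_surj surj_f_inv_f bij_is_inj)
  have irr: "irreducible (\<phi> q)" if q: "irreducible q" for q
  proof (rule irreducibleI)
    show "\<phi> q \<noteq> 0" using fi(2)[of q] mult(3)[OF \<psi>] q by (auto simp: irreducible_def)
    show "\<not> \<phi> q dvd 1"
      using dvd[OF \<psi>, of "\<phi> q" 1] q by (auto simp: fi mult(2)[OF \<psi>] irreducible_def)
    fix A B assume "\<phi> q = A * B"
    then have "q = ?\<psi> A * ?\<psi> B" using fi(2)[of q] by (simp add: mult(1)[OF \<psi>])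
    then have "?\<psi> A dvd 1 \<or> ?\<psi> B dvd 1" by (rule irreducibleD[OF q])
    then show "A dvd 1 \<or> B dvd 1"
      using dvd[OF \<phi>, of "?\<psi> A" 1] dvd[OF \<phi>, of "?\<psi> B" 1] by (auto simp: fi mult(2)[OF \<phi>])
  qed
  show ?thesis
    unfolding k_free_def
  proof
    assume "\<exists>q. irreducible q \<and> q ^ k dvd P"
    then obtain q where "irreducible q" "q ^ k dvd P" by blast
    with irr[of q] dvd[OF \<phi>, of "q ^ k" P] free show False by (auto simp: k_free_def pow)
  qed
qed

lemma automorphism_k_free_iff:
  assumes "algebra_automorphism \<phi>"
  shows "k_free k (\<phi> P) \<longleftrightarrow> k_free k P"
proof -
  have "inv_into UNIV \<phi> (\<phi> P) = P"
    using assms by (simp add: algebra_automorphism_def linear_bijection_def bij_is_inj)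
  then show ?thesis
    using automorphism_k_free_imp[OF assms] automorphism_k_free_imp[OF automorphism_inv[OF assms], of k "\<phi> P"]
    by auto
qed

lemma linear_bijection_smult:
  assumes "linear_bijection f" "c \<noteq> 0"
  shows "linear_bijection (\<lambda>P. smult c (f P))"
proof -
  have lin: "Vector_Spaces.linear smult smult f" and bij: "bij f"
    using assms(1) by (simp_all add: linear_bijection_def)
  have "bij (smult c :: 'a poly \<Rightarrow> 'a poly)"
    by (rule bij_betw_byWitness[where f' = "smult (inverse c)"]) (use assms(2) in auto)
  then have "bij (\<lambda>P. smult c (f P))" using bij_comp[OF bij] by (simp add: o_def)
  moreover have "Vector_Spaces.linear smult smult (\<lambda>P. smult c (f P))"
    by (rule linearI) (simp_all add: linear_simps[OF lin] smult_add_right mult.commute)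
  ultimately show ?thesis by (simp add: linear_bijection_def)
qed

lemma affine_substitution_inverse:
  fixes a b :: "'a::field"
  assumes "a \<noteq> 0"
  shows "pcompose (pcompose P [:b, a:]) [:- (b / a), 1 / a:] = P"
    "pcompose (pcompose P [:- (b / a), 1 / a:]) [:b, a:] = P"
  using assms by (simp_all flip: pcompose_assoc add: pcompose_pCons)

lemma affine_substitution_automorphism:
  fixes a b :: "'a::field"
  assumes "a \<noteq> 0"
  shows "algebra_automorphism (\<lambda>P. pcompose P [:b, a:])"
proof -
  have "bij (\<lambda>P. pcompose P [:b, a:])"
    by (rule bij_betw_byWitness[where f' = "\<lambda>P. pcompose P [:- (b / a), 1 / a:]"])
      (simp_all add: affine_substitution_inverse[OF assms])
  moreover have "Vector_Spaces.linear smult smult (\<lambda>P. pcompose P [:b, a:])"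
    by (rule linearI) (simp_all add: pcompose_add pcompose_smult)
  ultimately show ?thesis
    by (simp add: algebra_automorphism_def linear_bijection_def pcompose_1 pcompose_mult)
qed

lemma affine_substitution_k_fold_root_iff:
  fixes a b c :: "'a::field"
  assumes "a \<noteq> 0" "c \<noteq> 0"
  shows "(\<exists>x. k_fold_root k (smult c (pcompose P [:b, a:])) x) \<longleftrightarrow> (\<exists>x. k_fold_root k P x)"
proof -
  have imp: "\<exists>x. k_fold_root k (pcompose R [:d, e:]) x"
    if "\<exists>x. k_fold_root k R x" "e \<noteq> 0" for R and d e :: 'a
  proof -
    from that obtain y where "[:- y, 1:] ^ k dvd R" by (auto simp: k_fold_root_def)
    then have "[:- poly [:d, e:] ((y - d) / e), 1:] ^ k dvd R" using that(2) by simp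
    then show ?thesis unfolding k_fold_root_def by (blast intro: linear_power_dvd_pcompose)
  qed
  have "(\<exists>x. k_fold_root k (smult c (pcompose P [:b, a:])) x) \<longleftrightarrow> (\<exists>x. k_fold_root k (pcompose P [:b, a:]) x)"
    using assms(2) by (simp add: k_fold_root_def dvd_smult_iff)
  also have "\<dots> \<longleftrightarrow> (\<exists>x. k_fold_root k P x)"
    using imp[of P a b] imp[of "pcompose P [:b, a:]" "1 / a" "- (b / a)"] assms(1)
    by (auto simp: affine_substitution_inverse)
  finally show ?thesis .
qed

theorem theorem3p1:
  fixes k :: nat
  assumes "k \<ge> 2"
  shows "(\<forall>f :: 'a::field_char_0 poly \<Rightarrow> 'a poly.
            linear_bijection f \<and>
            (preserves f {P. k_free k P} \<or> preserves f {P. \<not> (\<exists>x. k_fold_root k P x)}) \<longrightarrow>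
            (\<exists>a b c. a \<noteq> 0 \<and> c \<noteq> 0 \<and> (\<forall>P. f P = smult c (pcompose P [:b, a:])))) \<and>
         {f :: 'a poly \<Rightarrow> 'a poly. linear_bijection f \<and> preserves f {P. k_free k P}} =
           {f. linear_bijection f \<and> preserves f {P. \<exists>x. k_fold_root k P x}} \<and>
         {f :: 'a poly \<Rightarrow> 'a poly. linear_bijection f \<and> preserves f {P. \<exists>x. k_fold_root k P x}} =
           {f. \<exists>c \<phi>. c \<noteq> 0 \<and> algebra_automorphism \<phi> \<and> f = (\<lambda>P. smult c (\<phi> P))}"
proof -
  let ?free = "{f :: 'a poly \<Rightarrow> 'a poly. linear_bijection f \<and> preserves f {P. k_free k P}}"
  let ?root = "{f :: 'a poly \<Rightarrow> 'a poly. linear_bijection f \<and> preserves f {P. \<exists>x. k_fold_root k P x}}"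
  let ?noroot = "{f :: 'a poly \<Rightarrow> 'a poly. linear_bijection f \<and> preserves f {P. \<not> (\<exists>x. k_fold_root k P x)}}"
  let ?aff = "{f :: 'a poly \<Rightarrow> 'a poly. \<exists>a b c. a \<noteq> 0 \<and> c \<noteq> 0 \<and> (\<forall>P. f P = smult c (pcompose P [:b, a:]))}"
  let ?aut = "{f :: 'a poly \<Rightarrow> 'a poly. \<exists>c \<phi>. c \<noteq> 0 \<and> algebra_automorphism \<phi> \<and> f = (\<lambda>P. smult c (\<phi> P))}"
  have bij: "linear_bijection f \<Longrightarrow> bij f" for f :: "'a poly \<Rightarrow> 'a poly"
    by (simp add: linear_bijection_def)
  have root_noroot: "?root = ?noroot"
    by (auto simp: bijection_preserves_iff bij simp del: not_ex)
  have free_aff: "?free \<subseteq> ?aff"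
  proof clarify
    fix f :: "'a poly \<Rightarrow> 'a poly"
    assume f: "linear_bijection f" "preserves f {P. k_free k P}"
    then have "power_factors monic_irreducibles k (f P) = {} \<longleftrightarrow> power_factors monic_irreducibles k P = {}" for P
      by (simp add: bijection_preserves_iff bij flip: k_free_iff_power_factors)
    then show "\<exists>a b c. a \<noteq> 0 \<and> c \<noteq> 0 \<and> (\<forall>P. f P = smult c (pcompose P [:b, a:]))"
      by (intro affine_form_of_preserver[OF monic_linears_subset order_refl assms f(1)])
  qed
  have root_aff: "?root \<subseteq> ?aff"
  proof clarify
    fix f :: "'a poly \<Rightarrow> 'a poly"
    assume f: "linear_bijection f" "preserves f {P. \<exists>x. k_fold_root k P x}"
    then have "power_factors monic_linears k (f P) = {} \<longleftrightarrow> power_factors monic_linears k P = {}" for P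
      by (simp add: bijection_preserves_iff bij k_fold_root_iff_power_factors)
    then show "\<exists>a b c. a \<noteq> 0 \<and> c \<noteq> 0 \<and> (\<forall>P. f P = smult c (pcompose P [:b, a:]))"
      by (intro affine_form_of_preserver[OF order_refl monic_linears_subset assms f(1)])
  qed
  have aff_aut: "?aff \<subseteq> ?aut"
  proof clarify
    fix f :: "'a poly \<Rightarrow> 'a poly" and a b c
    assume "a \<noteq> 0" "c \<noteq> 0" "\<forall>P. f P = smult c (pcompose P [:b, a:])"
    then show "\<exists>c \<phi>. c \<noteq> 0 \<and> algebra_automorphism \<phi> \<and> f = (\<lambda>P. smult c (\<phi> P))"
      using affine_substitution_automorphism[of a b] by blast
  qed
  have aut_lin: "linear_bijection f" if "f \<in> ?aut" for f
    using that linear_bijection_smult by (auto simp: algebra_automorphism_def)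
  have aut_free: "?aut \<subseteq> ?free"
  proof
    fix f assume f: "f \<in> ?aut"
    then obtain c \<phi> where c: "c \<noteq> 0" "algebra_automorphism \<phi>" "f = (\<lambda>P. smult c (\<phi> P))" by blast
    then have "k_free k (f P) \<longleftrightarrow> k_free k P" for P
      using automorphism_k_free_iff[of \<phi> k P] by (simp add: k_free_def dvd_smult_iff)
    with aut_lin[OF f] show "f \<in> ?free" by (simp add: bijection_preserves_iff bij)
  qed
  have aff_root: "?aff \<subseteq> ?root"
  proof
    fix f assume f: "f \<in> ?aff"
    then obtain a b c where abc: "a \<noteq> 0" "c \<noteq> 0" "\<And>P. f P = smult c (pcompose P [:b, a:])" by blast
    have "(\<exists>x. k_fold_root k (f P) x) \<longleftrightarrow> (\<exists>x. k_fold_root k P x)" for P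
      unfolding abc(3) using abc(1,2) by (rule affine_substitution_k_fold_root_iff)
    moreover have "linear_bijection f" using f aff_aut aut_lin by blast
    ultimately show "f \<in> ?root" by (simp add: bijection_preserves_iff bij)
  qed
  have root: "?root = ?aff" using root_aff aff_root by (rule subset_antisym)
  have aut: "?aut = ?aff" using subset_trans[OF aut_free free_aff] aff_aut by (rule subset_antisym)
  have free: "?free = ?aff"
    using free_aff subset_trans[OF aff_aut aut_free] by (rule subset_antisym)
  have noroot: "?noroot = ?aff" using root root_noroot by (rule trans[OF sym, rotated])
  show ?thesis
  proof (intro conjI allI impI)
    fix f :: "'a poly \<Rightarrow> 'a poly"
    assume "linear_bijection f \<and>
      (preserves f {P. k_free k P} \<or> preserves f {P. \<not> (\<exists>x. k_fold_root k P x)})"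
    then have "f \<in> ?free \<or> f \<in> ?noroot" by simp
    then have "f \<in> ?aff" unfolding free noroot by simp
    then show "\<exists>a b c. a \<noteq> 0 \<and> c \<noteq> 0 \<and> (\<forall>P. f P = smult c (pcompose P [:b, a:]))" by simp
  next
    show "?free = ?root" unfolding free root ..
    show "?root = ?aut" unfolding root aut ..
  qed
qed

end
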